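(* Let $(A,\bm{b},\bm{c})$ be an $s$-stage explicit Runge--Kutta method whose weights are all positive, i.e. $b_i>0$ for $i=1,\dots,s$. Then the method has effective order at most four; that is, it does not have effective order $q$ for any integer $q\ge 5$.
   Context: Runge--Kutta methods. An $s$-stage Runge--Kutta method is given by real coefficients $A=(a_{ij})\in\mathbb{R}^{s\times s}$, $\bm{b}\in\mathbb{R}^s$, with $c_i=\sum_j a_{ij}$; it is explicit if $a_{ij}=0$ for $j\ge i$. For $\bm{u}'=\bm{F}(\bm{u})$ it computes $\bm{Y}_i=\bm{u}^n+\Delta t\sum_j a_{ij}\bm{F}(\bm{Y}_j)$ and $\bm{u}^{n+1}=\bm{u}^n+\Delta t\sum_i b_i\bm{F}(\bm{Y}_i)$. Elementary weights. Let $r(t)$ be the number of vertices of a rooted tree $t$. Write $t=[t_1,\dots,t_m]$ for the tree obtained by joining the roots of $t_1,\dots,t_m$ to a new root; the single-vertex tree is $[\,]$. For a Runge--Kutta method put $D_i([t_1,\dots,t_m])=\prod_{k=1}^m\sum_j a_{ij}D_j(t_k)$ (empty product $=1$). Its elementary weight is $\alpha(t)=\sum_i b_iD_i(t)$, with $\alpha(\emptyset)=1$ for the empty tree. So each method corresponds to a function $\alpha$ on rooted trees. Butcher group $G$. $G$ is the set of real functions on rooted trees (including $\emptyset$) taking value $1$ at $\emptyset$, with product $$(\alpha\beta)(t)=\sum_{u}\beta(u)\prod_{t'\in t\setminus u}\alpha(t'),$$ where $u$ ranges over the empty tree and all subtrees of $t$ (connected vertex subsets) containing the root of $t$, and $t\setminus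 u$ is the forest of rooted trees left after deleting $u$ from $t$ (for $u=\emptyset$ it is $\{t\}$). The product $\alpha\beta$ corresponds to applying the method of $\alpha$ first and then the method of $\beta$. The identity $1\in G$ is $1$ at $\emptyset$ and $0$ at every nonempty tree. The exact evolution $E\in G$ is $E(t)=1/\gamma(t)$ for nonempty $t$, where $\gamma([t_1,\dots,t_m])=r(t)\prod_k\gamma(t_k)$. Effective order. A Runge--Kutta method with corresponding $\alpha\in G$ has effective order $q$ if there exist Runge--Kutta methods $S$ and $S^{-1}$ (not required to be explicit) with corresponding elements $\beta,\beta^{-1}\in G$ such that $(\beta^{-1}\beta)(t)=1(t)$ and $(\beta\alpha\beta^{-1})(t)=E(t)$ for every tree $t$ with $r(t)\le q$. *)

theory Defs
  imports Complex_Main "HOL-Library.Multiset"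
begin

section \<open>Rooted trees\<close>

text \<open>The datatype consists of the nonempty unordered rooted trees; a possibly empty tree is an
  \<open>rtree option\<close>, with \<^const>\<open>None\<close> as the empty tree.\<close>

datatype rtree = Node "rtree multiset"

primrec nverts :: "rtree \<Rightarrow> nat" where
  "nverts (Node ts) = 1 + (\<Sum>t\<in>#ts. nverts t)"

primrec order_tree :: "rtree option \<Rightarrow> nat" where
  "order_tree None = 0"
| "order_tree (Some t) = nverts t"

primrec tree_density :: "rtree \<Rightarrow> nat" where
  "tree_density (Node ts) = nverts (Node ts) * (\<Prod>t\<in>#ts. tree_density t)"


section \<open>Subtrees containing the root\<close>

text \<open>A connected vertex subset of \<open>[t\<^sub>1,\<dots>,t\<^sub>m]\<close> containing the root is an independent choice,
  for every \<open>k\<close>, of either no vertex of \<open>t\<^sub>k\<close> (then the whole of \<open>t\<^sub>k\<close> is left over) or a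
  connected vertex subset of \<open>t\<^sub>k\<close> containing its root. A choice is recorded as a pair: the
  branches that are kept and the forest that is left over. Choices are collected in a multiset,
  since distinct vertex subsets may give isomorphic trees and forests.\<close>

definition join_choices ::
    "('a multiset \<times> 'b multiset) multiset \<Rightarrow> ('a multiset \<times> 'b multiset) multiset
      \<Rightarrow> ('a multiset \<times> 'b multiset) multiset" where
  "join_choices M N = (\<Sum>(us, f)\<in>#M. image_mset (\<lambda>(vs, g). (us + vs, f + g)) N)"

primrec root_subtrees :: "rtree \<Rightarrow> (rtree \<times> rtree multiset) multiset" where
  "root_subtrees (Node ts) =
     image_mset (\<lambda>(us, f). (Node us, f))
       (fold_mset join_choices {#({#}, {#})#}
         (image_mset
           (\<lambda>t. add_mset ({#}, {#t#}) (image_mset (\<lambda>(u, f). ({#u#}, f)) (root_subtrees t)))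
           ts))"

text \<open>The order of folding in \<^const>\<open>root_subtrees\<close> is irrelevant.\<close>

lemma join_choices_left_commute:
  "join_choices L (join_choices M N) = join_choices M (join_choices L N)"
proof -
  define shift :: "'a multiset \<times> 'b multiset \<Rightarrow> ('a multiset \<times> 'b multiset) multiset \<Rightarrow> _" where
    "shift x N = image_mset (\<lambda>y. (fst x + fst y, snd x + snd y)) N" for x N
  have empty: "join_choices {#} N = {#}" for N :: "('a multiset \<times> 'b multiset) multiset"
    by (simp add: join_choices_def)
  have add: "join_choices (add_mset x M) N = shift x N + join_choices M N"
    for x and M N :: "('a multiset \<times> 'b multiset) multiset"
    by (simp add: join_choices_def shift_def case_prod_unfold)
  have union: "join_choices M (N + N') = join_choices M N + join_choices M N'"
    for M N N' :: "('a multiset \<times> 'b multiset) multiset"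
    by (induction M) (simp_all add: empty add, simp add: shift_def)
  have shift: "shift x (join_choices M N) = join_choices M (shift x N)" for x M N
    by (induction M)
      (simp_all add: empty add, simp_all add: shift_def multiset.map_comp o_def ac_simps)
  show ?thesis
    by (induction L) (simp_all add: empty add union shift, simp add: join_choices_def)
qed

interpretation join_choices: comp_fun_commute join_choices
  by unfold_locales (simp add: fun_eq_iff join_choices_left_commute)

text \<open>All pairs \<open>(u, t \<setminus> u)\<close> where \<open>u\<close> is empty or a subtree of \<open>t\<close> containing the root.\<close>

primrec cuts :: "rtree option \<Rightarrow> (rtree option \<times> rtree multiset) multiset" where
  "cuts None = {#(None, {#})#}"
| "cuts (Some t) =
     add_mset (None, {#t#}) (image_mset (\<lambda>(u, f). (Some u, f)) (root_subtrees t))"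


section \<open>The Butcher group\<close>

definition butcher_group :: "(rtree option \<Rightarrow> real) set" where
  "butcher_group = {\<alpha>. \<alpha> None = 1}"

definition butcher_mult ::
    "(rtree option \<Rightarrow> real) \<Rightarrow> (rtree option \<Rightarrow> real) \<Rightarrow> rtree option \<Rightarrow> real" where
  "butcher_mult \<alpha> \<beta> t = (\<Sum>(u, f)\<in>#cuts t. \<beta> u * (\<Prod>t'\<in>#f. \<alpha> (Some t')))"

primrec butcher_one :: "rtree option \<Rightarrow> real" where
  "butcher_one None = 1"
| "butcher_one (Some t) = 0"

primrec exact_evolution :: "rtree option \<Rightarrow> real" where
  "exact_evolution None = 1"
| "exact_evolution (Some t) = 1 / real (tree_density t)"


section \<open>Runge--Kutta methods\<close>

text \<open>Stages are numbered from \<open>0\<close>; coefficients with an index \<open>\<ge> stages M\<close> are never used. The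
  abscissae \<open>c\<^sub>i = \<Sum>\<^sub>j a\<^sub>i\<^sub>j\<close> are determined by the matrix and therefore not stored.\<close>

record rk_method =
  stages :: nat
  rk_A :: "nat \<Rightarrow> nat \<Rightarrow> real"
  rk_b :: "nat \<Rightarrow> real"

definition explicit_rk :: "rk_method \<Rightarrow> bool" where
  "explicit_rk M \<longleftrightarrow> (\<forall>i<stages M. \<forall>j<stages M. i \<le> j \<longrightarrow> rk_A M i j = 0)"

primrec stage_weight :: "rk_method \<Rightarrow> rtree \<Rightarrow> nat \<Rightarrow> real" where
  "stage_weight M (Node ts) =
     (\<lambda>i. \<Prod>t\<in>#ts. \<Sum>j<stages M. rk_A M i j * stage_weight M t j)"

primrec elementary_weight :: "rk_method \<Rightarrow> rtree option \<Rightarrow> real" where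
  "elementary_weight M None = 1"
| "elementary_weight M (Some t) = (\<Sum>i<stages M. rk_b M i * stage_weight M t i)"

lemma elementary_weight_in_butcher_group: "elementary_weight M \<in> butcher_group"
  by (simp add: butcher_group_def)

text \<open>\<open>S'\<close> plays the role of \<open>S\<^sup>-\<^sup>1\<close>; it need only be inverse to \<open>S\<close> on trees of order at most
  \<open>q\<close>, and neither method need be explicit. In \<^const>\<open>butcher_mult\<close> the left factor is applied first.\<close>

definition has_effective_order :: "rk_method \<Rightarrow> nat \<Rightarrow> bool" where
  "has_effective_order M q \<longleftrightarrow>
     (\<exists>S S'. \<forall>t. order_tree t \<le> q \<longrightarrow>
        butcher_mult (elementary_weight S') (elementary_weight S) t = butcher_one t \<and>
        butcher_mult
          (butcher_mult (elementary_weight S) (elementary_weight M)) (elementary_weight S') t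
          = exact_evolution t)"

end

theory Submission
  imports Defs
begin

text \<open>Right multiplication by \<open>\<beta>\<close> turns the condition of effective order five into
  \<open>\<beta>\<alpha> = E\<beta>\<close> on trees of order at most five. For a method with coefficients \<open>A\<close>, \<open>b\<close>, \<open>c\<close> put
  \<open>Q\<^sub>i = \<Sum>\<^sub>j a\<^sub>i\<^sub>j c\<^sub>j - c\<^sub>i\<^sup>2 / 2\<close>. The combination \<open>[[\<tau>],[\<tau>]] - [\<tau>,\<tau>,[\<tau>]] + [\<tau>,\<tau>,\<tau>,\<tau>] / 4\<close> of trees
  has elementary weight \<open>\<Sum>\<^sub>i b\<^sub>i Q\<^sub>i\<^sup>2\<close>. Its value at \<open>E\<close> is \<open>0\<close>, composing with \<open>E\<close> from the left
  leaves every \<open>Q\<^sub>i\<close> unchanged, and composing with \<open>\<beta>\<close> from the left adds the constant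
  \<open>\<kappa> = \<beta>([\<tau>]) - \<beta>(\<tau>)\<^sup>2 / 2\<close> to every \<open>Q\<^sub>i\<close>. Hence \<open>\<beta>\<alpha> = E\<beta>\<close> gives \<open>\<Sum>\<^sub>i b\<^sub>i (Q\<^sub>i + \<kappa>)\<^sup>2 = 0\<close> for the given
  method, so all its \<open>Q\<^sub>i\<close> equal \<open>-\<kappa>\<close>. The first stage of an explicit method has \<open>Q\<^sub>0 = 0\<close>;
  therefore all \<open>Q\<^sub>i\<close> vanish, which forces \<open>c\<^sub>i = 0\<close> successively for all \<open>i\<close> and contradicts
  the condition \<open>\<Sum>\<^sub>i b\<^sub>i c\<^sub>i = 1 / 2\<close> of order two.\<close>

section \<open>Products in the Butcher group as sums over stages\<close>

text \<open>The weight of a pair is multiplicative under componentwise union, so independent choices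
  factor by distributivity.\<close>

lemma sum_mset_join_choices:
  fixes g :: "'a \<Rightarrow> 'c::comm_semiring_1" and h :: "'b \<Rightarrow> 'c"
  shows "(\<Sum>(us, f)\<in>#join_choices M N. (\<Prod>u\<in>#us. g u) * (\<Prod>t\<in>#f. h t)) =
    (\<Sum>(us, f)\<in>#M. (\<Prod>u\<in>#us. g u) * (\<Prod>t\<in>#f. h t)) *
    (\<Sum>(us, f)\<in>#N. (\<Prod>u\<in>#us. g u) * (\<Prod>t\<in>#f. h t))"
proof (induction M)
  case empty
  show ?case by (simp add: join_choices_def)
next
  case (add x M)
  obtain us f where x: "x = (us, f)" by (cases x)
  have "(\<Sum>(vs, k)\<in>#image_mset (\<lambda>(vs, k). (us + vs, f + k)) N. (\<Prod>u\<in>#vs. g u) * (\<Prod>t\<in>#k. h t)) =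
      (\<Prod>u\<in>#us. g u) * (\<Prod>t\<in>#f. h t) * (\<Sum>(vs, k)\<in>#N. (\<Prod>u\<in>#vs. g u) * (\<Prod>t\<in>#k. h t))"
    by (induction N) (auto simp: algebra_simps)
  then show ?case
    using add.IH by (simp add: x join_choices_def algebra_simps)
qed

lemma sum_mset_fold_join_choices:
  fixes g :: "'a \<Rightarrow> 'c::comm_semiring_1" and h :: "'b \<Rightarrow> 'c"
  shows "(\<Sum>(us, f)\<in>#fold_mset join_choices {#({#}, {#})#} Ms. (\<Prod>u\<in>#us. g u) * (\<Prod>t\<in>#f. h t)) =
    (\<Prod>M\<in>#Ms. \<Sum>(us, f)\<in>#M. (\<Prod>u\<in>#us. g u) * (\<Prod>t\<in>#f. h t))"
  by (induction Ms) (simp_all add: sum_mset_join_choices)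

lemma nverts_root_subtrees: "(u, f) \<in># root_subtrees t \<Longrightarrow> nverts u \<le> nverts t"
proof (induction t arbitrary: u f)
  case (Node ts)
  define F where "F t = add_mset ({#}, {#t#}) (image_mset (\<lambda>(u, f). ({#u#}, f)) (root_subtrees t))"
    for t
  have F: "(\<Sum>u\<in>#us. nverts u) \<le> nverts t" if "t \<in># ts" "(us, f) \<in># F t" for t us f
    using that Node.IH[of t] by (auto simp: F_def)
  \<comment> \<open>Generalizing to \<open>ss\<close> inside \<open>ts\<close> keeps the bound
    \<open>F\<close> for single branches available in the inner induction.\<close>
  have "(\<Sum>u\<in>#us. nverts u) \<le> (\<Sum>t\<in>#ss. nverts t)"
    if "ss \<subseteq># ts" "(us, f) \<in># fold_mset join_choices {#({#}, {#})#} (image_mset F ss)" for ss us f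
    using that
  proof (induction ss arbitrary: us f)
    case empty
    then show ?case by simp
  next
    case (add t ss)
    have ss: "ss \<subseteq># ts" and t: "t \<in># ts"
      using add.prems(1) by (auto dest: mset_subset_eq_insertD subset_mset.less_imp_le)
    have "(us, f) \<in># join_choices (F t) (fold_mset join_choices {#({#}, {#})#} (image_mset F ss))"
      using add.prems(2) by simp
    then obtain vs k ws l where
      "(vs, k) \<in># F t" "(ws, l) \<in># fold_mset join_choices {#({#}, {#})#} (image_mset F ss)"
      and us: "us = vs + ws"
      by (auto simp: join_choices_def[of "F t"])
    then show ?case
      using F[OF t] add.IH[OF ss] by (fastforce intro: add_mono)
  qed
  from this[OF subset_mset.order_refl] show ?case
    using Node.prems by (auto simp: F_def[abs_def])
qed

text \<open>No root subtree outgrows its tree; hence identities known only up to order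
  \<open>q\<close> may be used inside a product.\<close>

lemma butcher_mult_cong_right:
  assumes "\<And>u. order_tree u \<le> order_tree t \<Longrightarrow> \<beta> u = \<beta>' u"
  shows "butcher_mult \<alpha> \<beta> t = butcher_mult \<alpha> \<beta>' t"
proof -
  have "order_tree u \<le> order_tree t" if "(u, f) \<in># cuts t" for u f
    using that nverts_root_subtrees by (cases t) auto
  then show ?thesis
    unfolding butcher_mult_def by (intro arg_cong[where f = sum_mset] image_mset_cong) (use assms in auto)
qed

lemma butcher_mult_one_right: "butcher_mult \<alpha> butcher_one (Some t) = \<alpha> (Some t)"
  by (simp add: butcher_mult_def multiset.map_comp o_def case_prod_unfold)

text \<open>The stage weights of \<open>M\<close> when the step starts from the result of a method with weights \<open>\<alpha>\<close>.\<close>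

primrec shifted_weight :: "(rtree option \<Rightarrow> real) \<Rightarrow> rk_method \<Rightarrow> rtree \<Rightarrow> nat \<Rightarrow> real" where
  "shifted_weight \<alpha> M (Node ts) =
     (\<lambda>i. \<Prod>t\<in>#ts. \<alpha> (Some t) + (\<Sum>j<stages M. rk_A M i j * shifted_weight \<alpha> M t j))"

lemma sum_mset_swap:
  "(\<Sum>x\<in>#X. \<Sum>j\<in>J. g x j) = (\<Sum>j\<in>J. \<Sum>x\<in>#X. g x j)" for g :: "_ \<Rightarrow> _ \<Rightarrow> 'a::comm_monoid_add"
  by (induction X) (simp_all add: sum.distrib)

text \<open>Each branch is either cut off, contributing \<alpha>, or replaced by one of its root
  subtrees, contributing a stage sum; these independent choices yield the product in
  \<open>shifted_weight\<close>.\<close>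

lemma sum_root_subtrees_stage_weight:
  "(\<Sum>(u, f)\<in>#root_subtrees t. stage_weight M u i * (\<Prod>t'\<in>#f. \<alpha> (Some t'))) = shifted_weight \<alpha> M t i"
proof (induction t arbitrary: i)
  case (Node ts)
  define F where "F t = add_mset ({#}, {#t#}) (image_mset (\<lambda>(u, f). ({#u#}, f)) (root_subtrees t))"
    for t
  define g where "g u = (\<Sum>j<stages M. rk_A M i j * stage_weight M u j)" for u
  have F: "(\<Sum>(us, f)\<in>#F t. (\<Prod>u\<in>#us. g u) * (\<Prod>t'\<in>#f. \<alpha> (Some t'))) =
      \<alpha> (Some t) + (\<Sum>j<stages M. rk_A M i j * shifted_weight \<alpha> M t j)" if "t \<in># ts" for t
  proof -
    have "(\<Sum>(u, f)\<in>#root_subtrees t. g u * (\<Prod>t'\<in>#f. \<alpha> (Some t'))) =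
        (\<Sum>j<stages M. rk_A M i j *
          (\<Sum>(u, f)\<in>#root_subtrees t. stage_weight M u j * (\<Prod>t'\<in>#f. \<alpha> (Some t'))))"
      by (simp add: g_def sum_distrib_right sum_mset_swap sum_mset_distrib_left case_prod_unfold mult.assoc)
    then show ?thesis
      by (simp add: F_def Node.IH[OF that, unfolded case_prod_unfold] multiset.map_comp o_def
          case_prod_unfold)
  qed
  have "(\<Sum>(u, f)\<in>#root_subtrees (Node ts). stage_weight M u i * (\<Prod>t'\<in>#f. \<alpha> (Some t'))) =
      (\<Sum>(us, f)\<in>#fold_mset join_choices {#({#}, {#})#} (image_mset F ts).
        (\<Prod>u\<in>#us. g u) * (\<Prod>t'\<in>#f. \<alpha> (Some t')))"
    by (simp add: F_def[abs_def] g_def[abs_def] multiset.map_comp o_def case_prod_unfold)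
  also have "\<dots> = (\<Prod>t\<in>#ts. \<alpha> (Some t) + (\<Sum>j<stages M. rk_A M i j * shifted_weight \<alpha> M t j))"
    unfolding sum_mset_fold_join_choices
    by (simp add: multiset.map_comp o_def F cong: image_mset_cong)
  finally show ?case by simp
qed

lemma butcher_mult_elementary_weight:
  "butcher_mult \<alpha> (elementary_weight M) (Some t) =
    \<alpha> (Some t) + (\<Sum>i<stages M. rk_b M i * shifted_weight \<alpha> M t i)"
proof -
  have "(\<Sum>(u, f)\<in>#root_subtrees t. elementary_weight M (Some u) * (\<Prod>t'\<in>#f. \<alpha> (Some t'))) =
      (\<Sum>i<stages M. rk_b M i *
        (\<Sum>(u, f)\<in>#root_subtrees t. stage_weight M u i * (\<Prod>t'\<in>#f. \<alpha> (Some t'))))"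
    by (simp add: sum_distrib_right sum_mset_swap sum_mset_distrib_left case_prod_unfold mult.assoc)
  then show ?thesis
    by (simp add: butcher_mult_def sum_root_subtrees_stage_weight[unfolded case_prod_unfold]
        multiset.map_comp o_def case_prod_unfold)
qed

lemma shifted_weight_cong:
  assumes "\<And>u. nverts u < nverts t \<Longrightarrow> \<alpha> (Some u) = \<alpha>' (Some u)"
  shows "shifted_weight \<alpha> M t i = shifted_weight \<alpha>' M t i"
  using assms
proof (induction t arbitrary: i)
  case (Node ts)
  have less: "nverts t < nverts (Node ts)" if "t \<in># ts" for t
    using that by (auto dest!: multi_member_split)
  have "shifted_weight \<alpha> M t j = shifted_weight \<alpha>' M t j" if "t \<in># ts" for t j
    using Node.IH[OF that] Node.prems less[OF that] by (meson order.strict_trans)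
  then show ?case
    using Node.prems[OF less] by (simp cong: image_mset_cong)
qed

lemma butcher_mult_cong_left:
  assumes "\<And>u. order_tree u \<le> order_tree (Some t) \<Longrightarrow> \<alpha> u = \<alpha>' u"
  shows "butcher_mult \<alpha> (elementary_weight M) (Some t) = butcher_mult \<alpha>' (elementary_weight M) (Some t)"
proof -
  have "shifted_weight \<alpha> M t i = shifted_weight \<alpha>' M t i" for i
    by (intro shifted_weight_cong assms) simp
  then show ?thesis
    using assms[of "Some t"] by (simp add: butcher_mult_elementary_weight)
qed

section \<open>Composition of methods\<close>

text \<open>The block tableau in which the stages of \<open>N\<close> start from the output of
  \<open>M\<close>. With it, associativity reduces to splitting stage sums, without combinatorics of
  nested cuts.\<close>

definition rk_compose :: "rk_method \<Rightarrow> rk_method \<Rightarrow> rk_method" where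
  "rk_compose M N = \<lparr>stages = stages M + stages N,
     rk_A = (\<lambda>i j. if i < stages M then (if j < stages M then rk_A M i j else 0)
       else if j < stages M then rk_b M j else rk_A N (i - stages M) (j - stages M)),
     rk_b = (\<lambda>i. if i < stages M then rk_b M i else rk_b N (i - stages M))\<rparr>"

lemma sum_lessThan_add:
  "(\<Sum>i<m + n. g i) = (\<Sum>i<m. g i) + (\<Sum>i<n. g (m + i))" for g :: "nat \<Rightarrow> 'a::comm_monoid_add"
  by (induction n) (simp_all add: add.assoc)

text \<open>Stages of \<open>M\<close> do not see \<open>N\<close>. For a stage of \<open>N\<close>,
  the value of \<alpha> plus the \<open>rk_b M\<close>-weighted stages of \<open>M\<close> is the
  product of \<alpha> with \<open>M\<close>, which acts as the new starting value.\<close>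

lemma shifted_weight_rk_compose:
  "i < stages M \<Longrightarrow> shifted_weight \<alpha> (rk_compose M N) t i = shifted_weight \<alpha> M t i"
  "shifted_weight \<alpha> (rk_compose M N) t (stages M + k) =
    shifted_weight (butcher_mult \<alpha> (elementary_weight M)) N t k"
proof (induction t arbitrary: i k)
  case (Node ts)
  {
    case 1
    then show ?case
      using Node.IH(1)
      by (simp add: sum_lessThan_add rk_compose_def cong: image_mset_cong)
  next
    case 2
    have "\<alpha> (Some t) + (\<Sum>j<stages (rk_compose M N).
          rk_A (rk_compose M N) (stages M + k) j * shifted_weight \<alpha> (rk_compose M N) t j) =
        butcher_mult \<alpha> (elementary_weight M) (Some t) + (\<Sum>j<stages N. rk_A N k j *
          shifted_weight (butcher_mult \<alpha> (elementary_weight M)) N t j)"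
      if "t \<in># ts" for t k
    proof -
      have "stages (rk_compose M N) = stages M + stages N"
        by (simp add: rk_compose_def)
      moreover have "rk_A (rk_compose M N) (stages M + k) j = rk_b M j" if "j < stages M" for j
        using that by (simp add: rk_compose_def)
      moreover have "rk_A (rk_compose M N) (stages M + k) (stages M + j) = rk_A N k j" for j
        by (simp add: rk_compose_def)
      ultimately show ?thesis
        using Node.IH[OF that] by (simp add: sum_lessThan_add butcher_mult_elementary_weight)
    qed
    then show ?case
      by (simp cong: image_mset_cong)
  }
qed

lemma butcher_mult_rk_compose:
  "butcher_mult \<alpha> (elementary_weight (rk_compose M N)) (Some t) =
    butcher_mult (butcher_mult \<alpha> (elementary_weight M)) (elementary_weight N) (Some t)"
proof -
  have "stages (rk_compose M N) = stages M + stages N"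
    by (simp add: rk_compose_def)
  moreover have "rk_b (rk_compose M N) i = rk_b M i" if "i < stages M" for i
    using that by (simp add: rk_compose_def)
  moreover have "rk_b (rk_compose M N) (stages M + i) = rk_b N i" for i
    by (simp add: rk_compose_def)
  ultimately show ?thesis
    by (simp add: butcher_mult_elementary_weight shifted_weight_rk_compose sum_lessThan_add)
qed

lemma shifted_weight_one: "shifted_weight butcher_one M t i = stage_weight M t i"
  by (induction t arbitrary: i) (simp cong: image_mset_cong)

lemma butcher_mult_one_left:
  "butcher_mult butcher_one (elementary_weight M) (Some t) = elementary_weight M (Some t)"
  by (simp add: butcher_mult_elementary_weight shifted_weight_one)

lemma elementary_weight_rk_compose:
  "elementary_weight (rk_compose M N) (Some t) =
    butcher_mult (elementary_weight M) (elementary_weight N) (Some t)"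
proof -
  have "butcher_mult (butcher_mult butcher_one (elementary_weight M)) (elementary_weight N) (Some t) =
      butcher_mult (elementary_weight M) (elementary_weight N) (Some t)"
  proof (rule butcher_mult_cong_left)
    show "butcher_mult butcher_one (elementary_weight M) u = elementary_weight M u" for u
      by (cases u) (simp_all add: butcher_mult_one_left, simp add: butcher_mult_def)
  qed
  then show ?thesis
    by (metis butcher_mult_one_left butcher_mult_rk_compose)
qed

section \<open>Eliminating the inverse starting method\<close>

lemma has_effective_orderE:
  assumes "has_effective_order M q"
  obtains S where "\<And>t. nverts t \<le> q \<Longrightarrow>
    butcher_mult (elementary_weight S) (elementary_weight M) (Some t) =
      butcher_mult exact_evolution (elementary_weight S) (Some t)"
proof -
  from assms obtain S S' where
    inverse: "\<And>t. order_tree t \<le> q \<Longrightarrow>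
      butcher_mult (elementary_weight S') (elementary_weight S) t = butcher_one t" and
    conj: "\<And>t. order_tree t \<le> q \<Longrightarrow>
      butcher_mult (butcher_mult (elementary_weight S) (elementary_weight M)) (elementary_weight S') t
        = exact_evolution t"
    unfolding has_effective_order_def by blast
  define X where "X = butcher_mult (elementary_weight S) (elementary_weight M)"
  have "X (Some t) = butcher_mult exact_evolution (elementary_weight S) (Some t)" if "nverts t \<le> q" for t
  proof -
    have "X (Some t) = butcher_mult X butcher_one (Some t)"
      by (simp add: butcher_mult_one_right)
    \<comment> \<open>The identity is expanded as \<open>S'\<close> followed by \<open>S\<close>, so
      that associativity exposes the conjugate of \<open>M\<close>.\<close>
    also have "\<dots> = butcher_mult X (elementary_weight (rk_compose S' S)) (Some t)"
    proof (rule butcher_mult_cong_right)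
      fix u assume u: "order_tree u \<le> order_tree (Some t)"
      show "butcher_one u = elementary_weight (rk_compose S' S) u"
      proof (cases u)
        case (Some v)
        then show ?thesis
          unfolding Some elementary_weight_rk_compose using u that Some by (subst inverse) auto
      qed simp
    qed
    also have "\<dots> = butcher_mult (butcher_mult X (elementary_weight S')) (elementary_weight S) (Some t)"
      by (rule butcher_mult_rk_compose)
    also have "\<dots> = butcher_mult exact_evolution (elementary_weight S) (Some t)"
      by (rule butcher_mult_cong_left) (use that conj in \<open>auto simp: X_def\<close>)
    finally show ?thesis .
  qed
  then show ?thesis
    using that unfolding X_def by blast
qed

section \<open>Stage defects and the trees of order five\<close>

definition abscissa :: "rk_method \<Rightarrow> nat \<Rightarrow> real" where
  "abscissa M i = (\<Sum>j<stages M. rk_A M i j)"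

text \<open>Residual of the simplifying condition C(2), stage order two.\<close>

definition stage_defect :: "rk_method \<Rightarrow> nat \<Rightarrow> real" where
  "stage_defect M i = (\<Sum>j<stages M. rk_A M i j * abscissa M j) - (abscissa M i)\<^sup>2 / 2"

abbreviation "tree1 \<equiv> Node {#}"
abbreviation "tree2 \<equiv> Node {#tree1#}"
abbreviation "tree5a \<equiv> Node {#tree2, tree2#}"
abbreviation "tree5b \<equiv> Node {#tree1, tree1, tree2#}"
abbreviation "tree5c \<equiv> Node {#tree1, tree1, tree1, tree1#}"

text \<open>The trees give X^2, X Y^2 and Y^4, where X and Y are the factors of the branches
  \<open>tree2\<close> and \<open>tree1\<close>; the left side is thus (X - Y^2/2)^2, and the mixed
  term \<open>\<alpha> (Some tree1) * abscissa M i\<close> cancels.\<close>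

lemma shifted_weight_defect:
  "shifted_weight \<alpha> M tree5a i - shifted_weight \<alpha> M tree5b i + shifted_weight \<alpha> M tree5c i / 4 =
    (stage_defect M i + (\<alpha> (Some tree2) - (\<alpha> (Some tree1))\<^sup>2 / 2))\<^sup>2"
proof -
  have "(\<Sum>j<stages M. rk_A M i j * (\<alpha> (Some tree1) + abscissa M j)) =
      \<alpha> (Some tree1) * abscissa M i + (\<Sum>j<stages M. rk_A M i j * abscissa M j)"
    by (simp add: abscissa_def distrib_left sum.distrib sum_distrib_left mult.commute)
  then show ?thesis
    by (simp add: stage_defect_def abscissa_def[symmetric] power2_eq_square field_simps)
qed

lemma butcher_mult_defect:
  fixes \<alpha> M
  defines "\<gamma> \<equiv> butcher_mult \<alpha> (elementary_weight M)"
  shows "\<gamma> (Some tree5a) - \<gamma> (Some tree5b) + \<gamma> (Some tree5c) / 4 =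
    \<alpha> (Some tree5a) - \<alpha> (Some tree5b) + \<alpha> (Some tree5c) / 4 +
    (\<Sum>i<stages M. rk_b M i * (stage_defect M i + (\<alpha> (Some tree2) - (\<alpha> (Some tree1))\<^sup>2 / 2))\<^sup>2)"
  unfolding \<gamma>_def butcher_mult_elementary_weight shifted_weight_defect[symmetric]
  by (simp only: distrib_left right_diff_distrib sum.distrib sum_subtractf sum_divide_distrib
      times_divide_eq_right add_divide_distrib)

lemma elementary_weight_defect:
  "elementary_weight M (Some tree5a) - elementary_weight M (Some tree5b) + elementary_weight M (Some tree5c) / 4 =
    (\<Sum>i<stages M. rk_b M i * (stage_defect M i)\<^sup>2)"
  using butcher_mult_defect[of butcher_one M] by (simp only: butcher_mult_one_left) simp

text \<open>Only earlier stages enter the sum in the defect, and their abscissae vanish by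
  induction, so zero defect leaves c_i^2 = 0.\<close>

lemma explicit_abscissa_zero:
  assumes "explicit_rk M" and "\<And>i. i < stages M \<Longrightarrow> stage_defect M i = 0" and "i < stages M"
  shows "abscissa M i = 0"
  using assms(3)
proof (induction i rule: less_induct)
  case (less i)
  have "rk_A M i j * abscissa M j = 0" if "j < stages M" for j
    using less that assms(1) by (cases "j < i") (auto simp: explicit_rk_def)
  then have "(\<Sum>j<stages M. rk_A M i j * abscissa M j) = 0"
    by (intro sum.neutral) simp
  then show ?case
    using assms(2)[OF less.prems] by (simp add: stage_defect_def)
qed

theorem theorem4p2:
  fixes M :: rk_method and q :: nat
  assumes "explicit_rk M"
    and "\<And>i. i < stages M \<Longrightarrow> rk_b M i > 0"
    and "q \<ge> 5"
  shows "\<not> has_effective_order M q"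
proof
  assume "has_effective_order M q"
  then obtain S where "\<And>t. nverts t \<le> q \<Longrightarrow>
      butcher_mult (elementary_weight S) (elementary_weight M) (Some t) =
        butcher_mult exact_evolution (elementary_weight S) (Some t)"
    by (rule has_effective_orderE) blast
  then have eq: "butcher_mult (elementary_weight S) (elementary_weight M) (Some t) =
      butcher_mult exact_evolution (elementary_weight S) (Some t)" if "nverts t \<le> 5" for t
    using that assms(3) by simp
  define \<kappa> where "\<kappa> = elementary_weight S (Some tree2) - (elementary_weight S (Some tree1))\<^sup>2 / 2"
  have order1: "(\<Sum>i<stages M. rk_b M i) = 1"
    using eq[of tree1] by (simp add: butcher_mult_elementary_weight)
  \<comment> \<open>The weights of \<open>S\<close> cancel: \<open>order1\<close> balances the term
    with its value at \<open>tree1\<close>.\<close>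
  have order2: "(\<Sum>i<stages M. rk_b M i * abscissa M i) = 1 / 2"
    using eq[of tree2] order1
    by (simp add: butcher_mult_elementary_weight abscissa_def distrib_left sum.distrib
        sum_distrib_right[symmetric])
  \<comment> \<open>For \<open>exact_evolution\<close> the combination is 1/20 - 1/10 + 1/20 = 0 and
    the shift is 1/2 - 1/2 = 0; what remains on the right is the combination for \<open>S\<close>,
    which also occurs on the left.\<close>
  have "(\<Sum>i<stages M. rk_b M i * (stage_defect M i + \<kappa>)\<^sup>2) = 0"
    using butcher_mult_defect[of "elementary_weight S" M] butcher_mult_defect[of exact_evolution S]
      elementary_weight_defect[of S] eq[of tree5a] eq[of tree5b] eq[of tree5c]
    unfolding \<kappa>_def[symmetric] by (simp del: elementary_weight.simps add: power2_eq_square)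
  then have "rk_b M i * (stage_defect M i + \<kappa>)\<^sup>2 = 0" if "i < stages M" for i
    using that assms(2) by (subst (asm) sum_nonneg_eq_0_iff) (auto simp: less_imp_le)
  then have defect: "stage_defect M i = - \<kappa>" if "i < stages M" for i
    using assms(2)[OF that] that by fastforce
  \<comment> \<open>Weights summing to 1 exclude a method without stages, so stage 0 is available to
    fix \<kappa>.\<close>
  have "0 < stages M"
    using order1 by (cases "stages M = 0") auto
  then have "stage_defect M 0 = 0"
    using assms(1) by (simp add: stage_defect_def abscissa_def explicit_rk_def)
  then have "stage_defect M i = 0" if "i < stages M" for i
    using defect[OF that] defect[OF \<open>0 < stages M\<close>] by simp
  then have "abscissa M i = 0" if "i < stages M" for i
    using explicit_abscissa_zero assms(1) that by blast
  then show False
    using order2 by simp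
qed

end
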